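(* Let $R$ be a ring and let $M$ be a non-zero left $R$-module with $S=\mathrm{End}_R(M)$. (1) If $M$ is coprime and satisfies condition $(\ast\ast)$: for every proper fully invariant submodule $K$ of $M$, $\mathrm{Ann}_R(K)\nsubseteq \mathrm{Ann}_R(M)$, then $M$ is endo-coprime. (2) If $R$ is commutative and $M$ is endo-coprime, then $M$ is coprime. (3) If $M$ is endo-coprime and $fi$-coretractable, then for every left ideal $I$ of $R$ either $IM=0$ or $IM=M$. (4) If $M$ is $fi$-coretractable and $S$ is a prime ring, then $M$ is fully coprime.
   Context: Rings are associative with non-zero identity and modules are unital. A submodule $K$ of $M$ is fully invariant if every $f\in S$ maps $K$ into $K$. $M$ is coprime if for every proper fully invariant submodule $K$ of $M$, $\mathrm{Ann}_R(M/K)=\mathrm{Ann}_R(M)$ (equivalently, for every proper submodule $K$). $M$ is endo-coprime if for every proper fully invariant submodule $K$ of $M$, the only $f\in S$ with $f(M)\subseteq K$ is $f=0$. $M$ is $fi$-coretractable if for every proper fully invariant submodule $K$ of $M$ there is a non-zero $f\in S$ with $f(K)=0$. $M$ is fully coprime if for every proper fully invariant submodule $K$ of $M$, $M$ is $M/K$-generated (a homomorphic image of a direct sum of copies of $M/K$). *)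

theory Defs
  imports "HOL-Algebra.Module" "HOL-Algebra.Ideal_Product"
begin

text \<open>
  The locale \<open>module\<close> of \<open>HOL-Algebra\<close> requires a commutative ring of scalars. The following locale is
  the same axiomatisation over an arbitrary ring. As in \<open>HOL-Algebra\<close>, a module is a record extending
  the ring record; its fields \<open>mult\<close> and \<open>one\<close> carry no meaning and are left unspecified below.
  The library predicate \<open>submodule\<close> does not involve commutativity and is used as it is.
\<close>

locale left_module = R?: ring R + M?: abelian_group M for R (structure) and M (structure) +
  assumes smult_closed [simp, intro]:
      "\<lbrakk>a \<in> carrier R; x \<in> carrier M\<rbrakk> \<Longrightarrow> a \<odot>\<^bsub>M\<^esub> x \<in> carrier M"
    and smult_l_distr:
      "\<lbrakk>a \<in> carrier R; b \<in> carrier R; x \<in> carrier M\<rbrakk> \<Longrightarrow>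
      (a \<oplus> b) \<odot>\<^bsub>M\<^esub> x = a \<odot>\<^bsub>M\<^esub> x \<oplus>\<^bsub>M\<^esub> b \<odot>\<^bsub>M\<^esub> x"
    and smult_r_distr:
      "\<lbrakk>a \<in> carrier R; x \<in> carrier M; y \<in> carrier M\<rbrakk> \<Longrightarrow>
      a \<odot>\<^bsub>M\<^esub> (x \<oplus>\<^bsub>M\<^esub> y) = a \<odot>\<^bsub>M\<^esub> x \<oplus>\<^bsub>M\<^esub> a \<odot>\<^bsub>M\<^esub> y"
    and smult_assoc1:
      "\<lbrakk>a \<in> carrier R; b \<in> carrier R; x \<in> carrier M\<rbrakk> \<Longrightarrow>
      (a \<otimes> b) \<odot>\<^bsub>M\<^esub> x = a \<odot>\<^bsub>M\<^esub> (b \<odot>\<^bsub>M\<^esub> x)"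
    and smult_one [simp]:
      "x \<in> carrier M \<Longrightarrow> \<one> \<odot>\<^bsub>M\<^esub> x = x"

text \<open>Homomorphisms are extensional, so that equality of homomorphisms is equality in HOL.\<close>

definition mod_hom ::
  "('a, 'r) ring_scheme \<Rightarrow> ('a, 'b, 'm) module_scheme \<Rightarrow> ('a, 'c, 'n) module_scheme \<Rightarrow> ('b \<Rightarrow> 'c) set"
  where "mod_hom R M N =
    {f \<in> carrier M \<rightarrow>\<^sub>E carrier N.
      (\<forall>x \<in> carrier M. \<forall>y \<in> carrier M. f (x \<oplus>\<^bsub>M\<^esub> y) = f x \<oplus>\<^bsub>N\<^esub> f y) \<and>
      (\<forall>r \<in> carrier R. \<forall>x \<in> carrier M. f (r \<odot>\<^bsub>M\<^esub> x) = r \<odot>\<^bsub>N\<^esub> f x)}"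

definition End_ring :: "('a, 'r) ring_scheme \<Rightarrow> ('a, 'b, 'm) module_scheme \<Rightarrow> ('b \<Rightarrow> 'b) ring"
  where "End_ring R M =
    \<lparr>carrier = mod_hom R M M,
     mult = compose (carrier M),
     one = (\<lambda>x \<in> carrier M. x),
     zero = (\<lambda>x \<in> carrier M. \<zero>\<^bsub>M\<^esub>),
     add = (\<lambda>f g. \<lambda>x \<in> carrier M. f x \<oplus>\<^bsub>M\<^esub> g x)\<rparr>"

definition quot_module :: "('a, 'b, 'm) module_scheme \<Rightarrow> 'b set \<Rightarrow> ('a, 'b set) module"
  where "quot_module M K =
    \<lparr>carrier = a_rcosets\<^bsub>M\<^esub> K,
     mult = undefined,
     one = undefined,
     zero = K,
     add = set_add M,
     smult = (\<lambda>r X. \<Union>x \<in> X. K +>\<^bsub>M\<^esub> (r \<odot>\<^bsub>M\<^esub> x))\<rparr>"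

definition direct_sum_copies ::
  "'i set \<Rightarrow> ('a, 'b, 'm) module_scheme \<Rightarrow> ('a, 'i \<Rightarrow> 'b) module"
  where "direct_sum_copies I N =
    \<lparr>carrier = {x \<in> I \<rightarrow>\<^sub>E carrier N. finite {i \<in> I. x i \<noteq> \<zero>\<^bsub>N\<^esub>}},
     mult = undefined,
     one = undefined,
     zero = (\<lambda>i \<in> I. \<zero>\<^bsub>N\<^esub>),
     add = (\<lambda>x y. \<lambda>i \<in> I. x i \<oplus>\<^bsub>N\<^esub> y i),
     smult = (\<lambda>r x. \<lambda>i \<in> I. r \<odot>\<^bsub>N\<^esub> x i)\<rparr>"

text \<open>
  A definition cannot quantify over the type of the index set. Here the index set ranges over the sets
  of functions from \<open>N\<close> to \<open>M\<close>; lemma \<open>generated_byI\<close> below shows that an epimorphism from a direct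
  sum of copies of \<open>N\<close> over an index set of any type gives one over such an index set.
\<close>

definition generated_by ::
  "('a, 'r) ring_scheme \<Rightarrow> ('a, 'b, 'm) module_scheme \<Rightarrow> ('a, 'c, 'n) module_scheme \<Rightarrow> bool"
  where "generated_by R N M \<longleftrightarrow>
    (\<exists>I :: ('b \<Rightarrow> 'c) set. \<exists>h \<in> mod_hom R (direct_sum_copies I N) M.
       h ` carrier (direct_sum_copies I N) = carrier M)"

definition annihilator ::
  "('a, 'r) ring_scheme \<Rightarrow> ('a, 'b, 'm) module_scheme \<Rightarrow> 'b set \<Rightarrow> 'a set"
  where "annihilator R M X = {r \<in> carrier R. \<forall>x \<in> X. r \<odot>\<^bsub>M\<^esub> x = \<zero>\<^bsub>M\<^esub>}"

definition fully_invariant ::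
  "('a, 'r) ring_scheme \<Rightarrow> ('a, 'b, 'm) module_scheme \<Rightarrow> 'b set \<Rightarrow> bool"
  where "fully_invariant R M K \<longleftrightarrow>
    submodule K R M \<and> (\<forall>f \<in> carrier (End_ring R M). f ` K \<subseteq> K)"

definition proper_fully_invariant ::
  "('a, 'r) ring_scheme \<Rightarrow> ('a, 'b, 'm) module_scheme \<Rightarrow> 'b set \<Rightarrow> bool"
  where "proper_fully_invariant R M K \<longleftrightarrow> fully_invariant R M K \<and> K \<noteq> carrier M"

definition coprime_module :: "('a, 'r) ring_scheme \<Rightarrow> ('a, 'b, 'm) module_scheme \<Rightarrow> bool"
  where "coprime_module R M \<longleftrightarrow>
    (\<forall>K. proper_fully_invariant R M K \<longrightarrow>
      annihilator R (quot_module M K) (carrier (quot_module M K)) = annihilator R M (carrier M))"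

definition endo_coprime :: "('a, 'r) ring_scheme \<Rightarrow> ('a, 'b, 'm) module_scheme \<Rightarrow> bool"
  where "endo_coprime R M \<longleftrightarrow>
    (\<forall>K. proper_fully_invariant R M K \<longrightarrow>
      (\<forall>f \<in> carrier (End_ring R M). f ` carrier M \<subseteq> K \<longrightarrow> f = \<zero>\<^bsub>End_ring R M\<^esub>))"

definition fi_coretractable :: "('a, 'r) ring_scheme \<Rightarrow> ('a, 'b, 'm) module_scheme \<Rightarrow> bool"
  where "fi_coretractable R M \<longleftrightarrow>
    (\<forall>K. proper_fully_invariant R M K \<longrightarrow>
      (\<exists>f \<in> carrier (End_ring R M). f \<noteq> \<zero>\<^bsub>End_ring R M\<^esub> \<and> f ` K = {\<zero>\<^bsub>M\<^esub>}))"

definition fully_coprime :: "('a, 'r) ring_scheme \<Rightarrow> ('a, 'b, 'm) module_scheme \<Rightarrow> bool"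
  where "fully_coprime R M \<longleftrightarrow>
    (\<forall>K. proper_fully_invariant R M K \<longrightarrow> generated_by R (quot_module M K) M)"

definition left_ideal :: "'a set \<Rightarrow> ('a, 'r) ring_scheme \<Rightarrow> bool"
  where "left_ideal I R \<longleftrightarrow>
    additive_subgroup I R \<and> (\<forall>r \<in> carrier R. \<forall>a \<in> I. r \<otimes>\<^bsub>R\<^esub> a \<in> I)"

definition left_ideal_smult :: "'a set \<Rightarrow> ('a, 'b, 'm) module_scheme \<Rightarrow> 'b set"
  where "left_ideal_smult I M =
    {\<Oplus>\<^bsub>M\<^esub> i \<in> {..<n}. a i \<odot>\<^bsub>M\<^esub> x i | (n :: nat) a x.
      a \<in> {..<n} \<rightarrow> I \<and> x \<in> {..<n} \<rightarrow> carrier M}"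

text \<open>The library notion \<open>primeideal\<close> is restricted to commutative rings.\<close>

definition prime_ring :: "('a, 'r) ring_scheme \<Rightarrow> bool"
  where "prime_ring S \<longleftrightarrow>
    ring S \<and> \<one>\<^bsub>S\<^esub> \<noteq> \<zero>\<^bsub>S\<^esub> \<and>
    (\<forall>I J. ideal I S \<longrightarrow> ideal J S \<longrightarrow> ideal_prod S I J = {\<zero>\<^bsub>S\<^esub>} \<longrightarrow>
       I = {\<zero>\<^bsub>S\<^esub>} \<or> J = {\<zero>\<^bsub>S\<^esub>})"

lemma (in left_module) smult_r_null:
  assumes "a \<in> carrier R" shows "a \<odot>\<^bsub>M\<^esub> \<zero>\<^bsub>M\<^esub> = \<zero>\<^bsub>M\<^esub>"
proof -
  have "a \<odot>\<^bsub>M\<^esub> \<zero>\<^bsub>M\<^esub> \<oplus>\<^bsub>M\<^esub> a \<odot>\<^bsub>M\<^esub> \<zero>\<^bsub>M\<^esub> = a \<odot>\<^bsub>M\<^esub> \<zero>\<^bsub>M\<^esub>"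
    using smult_r_distr[of a "\<zero>\<^bsub>M\<^esub>" "\<zero>\<^bsub>M\<^esub>"] assms by simp
  then show ?thesis using assms by (simp add: M.add.r_cancel_one)
qed

lemma mod_hom_zero:
  assumes "abelian_group A" "abelian_group B" "f \<in> mod_hom R A B"
  shows "f \<zero>\<^bsub>A\<^esub> = \<zero>\<^bsub>B\<^esub>"
proof -
  interpret A: abelian_group A by fact
  interpret B: abelian_group B by fact
  have "f \<zero>\<^bsub>A\<^esub> \<in> carrier B" using assms(3) by (auto simp: mod_hom_def)
  moreover have "f (\<zero>\<^bsub>A\<^esub> \<oplus>\<^bsub>A\<^esub> \<zero>\<^bsub>A\<^esub>) = f \<zero>\<^bsub>A\<^esub> \<oplus>\<^bsub>B\<^esub> f \<zero>\<^bsub>A\<^esub>"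
    using assms(3) unfolding mod_hom_def by blast
  then have "f \<zero>\<^bsub>A\<^esub> = f \<zero>\<^bsub>A\<^esub> \<oplus>\<^bsub>B\<^esub> f \<zero>\<^bsub>A\<^esub>" by simp
  ultimately show ?thesis by (metis B.add.r_cancel_one)
qed

lemma generated_byI:
  fixes I :: "'i set" and N :: "('a, 'b, 'm) module_scheme" and M :: "('a, 'c, 'n) module_scheme"
  assumes N: "left_module R N" and M: "left_module R M"
    and h: "h \<in> mod_hom R (direct_sum_copies I N) M"
    and surj: "h ` carrier (direct_sum_copies I N) = carrier M"
  shows "generated_by R N M"
proof -
  interpret N: left_module R N by fact
  interpret M: left_module R M by fact
  define e where "e = (\<lambda>i n. \<lambda>j\<in>I. if j = i then n else \<zero>\<^bsub>N\<^esub>)"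
  define \<phi> where "\<phi> = (\<lambda>i. \<lambda>n\<in>carrier N. h (e i n))"
  define J where "J = \<phi> ` I"
  define s where "s = (\<lambda>y. {g \<in> J. y g \<noteq> \<zero>\<^bsub>N\<^esub>})"
  let ?D = "direct_sum_copies I N" and ?E = "direct_sum_copies J N"
  define k where "k = (\<lambda>y\<in>carrier ?E. \<Oplus>\<^bsub>M\<^esub> g\<in>s y. g (y g))"
  have hD: "h x \<in> carrier M" if "x \<in> carrier ?D" for x
    using h that by (auto simp: mod_hom_def)
  have hadd: "h (x \<oplus>\<^bsub>?D\<^esub> y) = h x \<oplus>\<^bsub>M\<^esub> h y" if "x \<in> carrier ?D" "y \<in> carrier ?D" for x y
    using h that by (auto simp: mod_hom_def)
  have hsm: "h (r \<odot>\<^bsub>?D\<^esub> x) = r \<odot>\<^bsub>M\<^esub> h x" if "x \<in> carrier ?D" "r \<in> carrier R" for x r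
    using h that by (auto simp: mod_hom_def)
  have eD: "e i n \<in> carrier ?D" if "i \<in> I" "n \<in> carrier N" for i n
  proof -
    have "{j \<in> I. e i n j \<noteq> \<zero>\<^bsub>N\<^esub>} \<subseteq> {i}" by (auto simp: e_def)
    then have "finite {j \<in> I. e i n j \<noteq> \<zero>\<^bsub>N\<^esub>}" using finite_subset by blast
    then show ?thesis using that by (auto simp: direct_sum_copies_def e_def)
  qed
  have \<phi>: "\<phi> i \<in> mod_hom R N M" if i: "i \<in> I" for i
  proof -
    have 1: "e i (x \<oplus>\<^bsub>N\<^esub> y) = e i x \<oplus>\<^bsub>?D\<^esub> e i y" if "x \<in> carrier N" "y \<in> carrier N" for x y
      using that by (auto simp: direct_sum_copies_def e_def)
    have 2: "e i (r \<odot>\<^bsub>N\<^esub> x) = r \<odot>\<^bsub>?D\<^esub> e i x" if "x \<in> carrier N" "r \<in> carrier R" for x r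
      using that by (auto simp: direct_sum_copies_def e_def N.smult_r_null)
    show ?thesis using i eD hD hadd hsm by (auto simp: mod_hom_def \<phi>_def 1 2)
  qed
  have J: "g \<in> mod_hom R N M" if "g \<in> J" for g using that \<phi> by (auto simp: J_def)
  have gz: "g \<zero>\<^bsub>N\<^esub> = \<zero>\<^bsub>M\<^esub>" if "g \<in> J" for g
    using mod_hom_zero[OF N.M.abelian_group_axioms M.M.abelian_group_axioms J[OF that]] .
  have gc: "g n \<in> carrier M" if "g \<in> J" "n \<in> carrier N" for g n
    using J[OF that(1)] that(2) by (auto simp: mod_hom_def)
  have yc: "y g \<in> carrier N" if "y \<in> carrier ?E" "g \<in> J" for y g
    using that by (auto simp: direct_sum_copies_def)
  have sfin: "finite (s y)" if "y \<in> carrier ?E" for y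
    using that by (auto simp: direct_sum_copies_def s_def)
  have kF: "k y = (\<Oplus>\<^bsub>M\<^esub> g\<in>F. g (y g))"
    if "y \<in> carrier ?E" "finite F" "s y \<subseteq> F" "F \<subseteq> J" for y F
  proof -
    have "(\<Oplus>\<^bsub>M\<^esub> g\<in>s y. g (y g)) = (\<Oplus>\<^bsub>M\<^esub> g\<in>F. g (y g))"
      by (rule M.M.add.finprod_mono_neutral_cong_left)
        (use that gz gc yc in \<open>auto simp: s_def subset_iff Pi_def\<close>)
    then show ?thesis using that by (simp add: k_def)
  qed
  have kc: "k y \<in> carrier M" if "y \<in> carrier ?E" for y
    using that gc yc by (auto simp: k_def s_def intro!: M.M.finsum_closed)
  have Eadd: "y \<oplus>\<^bsub>?E\<^esub> z \<in> carrier ?E" if "y \<in> carrier ?E" "z \<in> carrier ?E" for y z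
  proof -
    have "{g \<in> J. (y \<oplus>\<^bsub>?E\<^esub> z) g \<noteq> \<zero>\<^bsub>N\<^esub>} \<subseteq> s y \<union> s z"
      by (auto simp: s_def direct_sum_copies_def)
    then have "finite {g \<in> J. (y \<oplus>\<^bsub>?E\<^esub> z) g \<noteq> \<zero>\<^bsub>N\<^esub>}"
      using sfin that by (meson finite_UnI finite_subset)
    then show ?thesis using that by (auto simp: direct_sum_copies_def)
  qed
  have Esm: "r \<odot>\<^bsub>?E\<^esub> y \<in> carrier ?E" if "y \<in> carrier ?E" "r \<in> carrier R" for y r
  proof -
    have "{g \<in> J. (r \<odot>\<^bsub>?E\<^esub> y) g \<noteq> \<zero>\<^bsub>N\<^esub>} \<subseteq> s y"
      using that by (auto simp: s_def direct_sum_copies_def N.smult_r_null)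
    then have "finite {g \<in> J. (r \<odot>\<^bsub>?E\<^esub> y) g \<noteq> \<zero>\<^bsub>N\<^esub>}"
      using sfin that by (meson finite_subset)
    then show ?thesis using that by (auto simp: direct_sum_copies_def)
  qed
  have kadd: "k (y \<oplus>\<^bsub>?E\<^esub> z) = k y \<oplus>\<^bsub>M\<^esub> k z" if y: "y \<in> carrier ?E" and z: "z \<in> carrier ?E" for y z
  proof -
    let ?F = "s y \<union> s z"
    have F: "finite ?F" "?F \<subseteq> J" using sfin y z by (auto simp: s_def)
    have S: "s (y \<oplus>\<^bsub>?E\<^esub> z) \<subseteq> ?F" by (auto simp: s_def direct_sum_copies_def)
    have "k (y \<oplus>\<^bsub>?E\<^esub> z) = (\<Oplus>\<^bsub>M\<^esub> g\<in>?F. g ((y \<oplus>\<^bsub>?E\<^esub> z) g))"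
      by (rule kF[OF Eadd[OF y z] F(1) S F(2)])
    also have "\<dots> = (\<Oplus>\<^bsub>M\<^esub> g\<in>?F. g (y g) \<oplus>\<^bsub>M\<^esub> g (z g))"
    proof (rule M.M.finsum_cong')
      fix g assume "g \<in> ?F"
      then have g: "g \<in> J" using F by blast
      then show "g ((y \<oplus>\<^bsub>?E\<^esub> z) g) = g (y g) \<oplus>\<^bsub>M\<^esub> g (z g)"
        using J[OF g] yc[OF y g] yc[OF z g] by (simp add: mod_hom_def direct_sum_copies_def)
    next
      show "(\<lambda>g. g (y g) \<oplus>\<^bsub>M\<^esub> g (z g)) \<in> ?F \<rightarrow> carrier M"
        using F gc yc y z by (auto simp: subset_iff)
    qed simp
    also have "\<dots> = (\<Oplus>\<^bsub>M\<^esub> g\<in>?F. g (y g)) \<oplus>\<^bsub>M\<^esub> (\<Oplus>\<^bsub>M\<^esub> g\<in>?F. g (z g))"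
      by (rule M.M.finsum_addf) (use F gc yc y z in \<open>auto simp: subset_iff\<close>)
    also have "\<dots> = k y \<oplus>\<^bsub>M\<^esub> k z"
      using kF[OF y F(1) _ F(2)] kF[OF z F(1) _ F(2)] by simp
    finally show ?thesis .
  qed
  have fsm: "r \<odot>\<^bsub>M\<^esub> (\<Oplus>\<^bsub>M\<^esub> g\<in>F. u g) = (\<Oplus>\<^bsub>M\<^esub> g\<in>F. r \<odot>\<^bsub>M\<^esub> u g)"
    if "finite F" "u \<in> F \<rightarrow> carrier M" "r \<in> carrier R" for r u and F :: "('b \<Rightarrow> 'c) set"
    using that by (induction F) (auto simp: M.smult_r_null M.smult_r_distr Pi_def)
  have ksm: "k (r \<odot>\<^bsub>?E\<^esub> y) = r \<odot>\<^bsub>M\<^esub> k y" if y: "y \<in> carrier ?E" and r: "r \<in> carrier R" for y r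
  proof -
    let ?F = "s y"
    have F: "finite ?F" "?F \<subseteq> J" using sfin y by (auto simp: s_def)
    have S: "s (r \<odot>\<^bsub>?E\<^esub> y) \<subseteq> ?F" using r by (auto simp: s_def direct_sum_copies_def N.smult_r_null)
    have "k (r \<odot>\<^bsub>?E\<^esub> y) = (\<Oplus>\<^bsub>M\<^esub> g\<in>?F. g ((r \<odot>\<^bsub>?E\<^esub> y) g))"
      by (rule kF[OF Esm[OF y r] F(1) S F(2)])
    also have "\<dots> = (\<Oplus>\<^bsub>M\<^esub> g\<in>?F. r \<odot>\<^bsub>M\<^esub> g (y g))"
    proof (rule M.M.finsum_cong')
      fix g assume "g \<in> ?F"
      then have g: "g \<in> J" using F by blast
      then show "g ((r \<odot>\<^bsub>?E\<^esub> y) g) = r \<odot>\<^bsub>M\<^esub> g (y g)"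
        using J[OF g] yc[OF y g] r by (simp add: mod_hom_def direct_sum_copies_def)
    next
      show "(\<lambda>g. r \<odot>\<^bsub>M\<^esub> g (y g)) \<in> ?F \<rightarrow> carrier M"
        using F gc yc y r by (auto simp: subset_iff)
    qed simp
    also have "\<dots> = r \<odot>\<^bsub>M\<^esub> k y"
      using fsm[OF F(1) _ r, of "\<lambda>g. g (y g)"] kF[OF y F(1) _ F(2)] F gc yc y
      by (simp add: subset_iff Pi_def)
    finally show ?thesis .
  qed
  have kh: "k \<in> mod_hom R ?E M"
    using kc kadd ksm by (auto simp: mod_hom_def k_def)
  have single: "h (e i n) \<in> k ` carrier ?E" if i: "i \<in> I" and n: "n \<in> carrier N" for i n
  proof -
    let ?y = "\<lambda>g\<in>J. if g = \<phi> i then n else \<zero>\<^bsub>N\<^esub>"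
    have iJ: "\<phi> i \<in> J" using i by (simp add: J_def)
    have S: "s ?y \<subseteq> {\<phi> i}" by (auto simp: s_def)
    then have "finite (s ?y)" using finite_subset by blast
    then have y: "?y \<in> carrier ?E" using n by (auto simp: direct_sum_copies_def s_def)
    have "k ?y = (\<Oplus>\<^bsub>M\<^esub> g\<in>{\<phi> i}. g (?y g))" by (rule kF[OF y _ S]) (use iJ in auto)
    also have "\<dots> = \<phi> i n"
      using iJ gc[OF iJ n] by (simp add: Pi_def)
    also have "\<dots> = h (e i n)" using n by (simp add: \<phi>_def)
    finally show ?thesis using y by (metis imageI)
  qed
  have main: "h x \<in> k ` carrier ?E"
    if "finite F" "x \<in> carrier ?D" "{i \<in> I. x i \<noteq> \<zero>\<^bsub>N\<^esub>} \<subseteq> F" "F \<subseteq> I" for F x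
    using that
  proof (induction F arbitrary: x)
    case empty
    let ?z = "\<lambda>g\<in>J. \<zero>\<^bsub>N\<^esub>"
    have z: "?z \<in> carrier ?E" by (auto simp: direct_sum_copies_def)
    have "k ?z = \<zero>\<^bsub>M\<^esub>" using kF[OF z, of "{}"] by (simp add: s_def)
    have x0: "x j = \<zero>\<^bsub>N\<^esub>" if "j \<in> I" for j using empty(2) that by blast
    have xE: "x \<in> extensional I" using empty(1) by (simp add: direct_sum_copies_def PiE_def)
    have "x = x \<oplus>\<^bsub>?D\<^esub> x"
      by (rule extensionalityI[OF xE]) (simp_all add: direct_sum_copies_def x0)
    with hadd[OF empty(1) empty(1)] have "h x \<oplus>\<^bsub>M\<^esub> h x = h x" by argo
    then have "h x = \<zero>\<^bsub>M\<^esub>" using hD[OF empty(1)] M.M.add.r_cancel_one by blast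
    then show ?case using z \<open>k ?z = \<zero>\<^bsub>M\<^esub>\<close> by (metis imageI)
  next
    case (insert i F)
    have i: "i \<in> I" and xi: "x i \<in> carrier N" and F: "F \<subseteq> I"
      using insert.prems by (auto simp: direct_sum_copies_def)
    let ?x = "\<lambda>j\<in>I. if j = i then \<zero>\<^bsub>N\<^esub> else x j"
    have S: "{j \<in> I. ?x j \<noteq> \<zero>\<^bsub>N\<^esub>} \<subseteq> F" using insert.prems by auto
    then have "finite {j \<in> I. ?x j \<noteq> \<zero>\<^bsub>N\<^esub>}" using insert.hyps(1) by (rule finite_subset)
    moreover have "?x \<in> I \<rightarrow>\<^sub>E carrier N"
      using insert.prems(1) by (auto simp: direct_sum_copies_def)
    ultimately have x': "?x \<in> carrier ?D" by (simp add: direct_sum_copies_def)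
    with S have "h ?x \<in> k ` carrier ?E" using insert.IH F by blast
    then obtain y where y: "y \<in> carrier ?E" "h ?x = k y" by blast
    obtain z where z: "z \<in> carrier ?E" "h (e i (x i)) = k z" using single[OF i xi] by blast
    have xN: "x j \<in> carrier N" if "j \<in> I" for j
      using insert.prems(1) that by (auto simp: direct_sum_copies_def)
    have "x \<in> extensional I" using insert.prems(1) by (simp add: direct_sum_copies_def PiE_def)
    then have "x = e i (x i) \<oplus>\<^bsub>?D\<^esub> ?x"
      by (rule extensionalityI) (simp_all add: direct_sum_copies_def e_def xN xi)
    then have "h x = h (e i (x i)) \<oplus>\<^bsub>M\<^esub> h ?x" using hadd[OF eD[OF i xi] x'] by simp
    also have "\<dots> = k (z \<oplus>\<^bsub>?E\<^esub> y)" using kadd y z by simp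
    finally show ?case using Eadd[OF z(1) y(1)] by blast
  qed
  have "carrier M \<subseteq> k ` carrier ?E"
  proof
    fix m assume "m \<in> carrier M"
    then obtain x where x: "x \<in> carrier ?D" "m = h x" using surj by blast
    show "m \<in> k ` carrier ?E"
      unfolding x(2) by (rule main[OF _ x(1) subset_refl]) (use x in \<open>auto simp: direct_sum_copies_def\<close>)
  qed
  then have "k ` carrier ?E = carrier M" using kc by blast
  then show ?thesis unfolding generated_by_def using kh by blast
qed

end

theory Submission
  imports Defs "HOL-Algebra.Free_Abelian_Groups"
begin

text \<open>
  Each part compares a given submodule with a second, fully invariant one built from it, and asks
  whether the second is all of \<open>M\<close>. Write \<open>IM\<close> for the submodule generated by the products of
  elements of a left ideal \<open>I\<close> and elements of \<open>M\<close>. Endomorphisms commute with scalars, so \<open>IM\<close> is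
  fully invariant (\<open>left_ideal_smult_fully_invariant\<close>).

  Coprime modules with \<open>(\<ast>\<ast>)\<close>: let \<open>f(M) \<subseteq> K\<close> and \<open>A = Ann(K)\<close>. If \<open>AM\<close> were proper, then
  \<open>A \<subseteq> Ann(M/AM) = Ann(M)\<close> against \<open>(\<ast>\<ast>)\<close>. So \<open>M = AM\<close> and
  \<open>f(M) = A f(M) \<subseteq> AK = 0\<close>.

  Commutative scalars: multiplication by \<open>r\<close> is then an endomorphism, with image in \<open>K\<close> exactly if
  \<open>r\<close> annihilates \<open>M/K\<close>.

  Endo-coprime and \<open>fi\<close>-coretractable modules: if \<open>IM\<close> is proper, some \<open>f \<noteq> 0\<close> kills it. The set
  of all \<open>x\<close> with \<open>IRx = 0\<close> is a fully invariant submodule, and it contains \<open>f(M)\<close> because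
  \<open>IR f(M) = f(IRM) \<subseteq> f(IM) = 0\<close>. As \<open>f \<noteq> 0\<close>, it is \<open>M\<close>, that is, \<open>IM = 0\<close>.

  Prime endomorphism rings: for a proper fully invariant \<open>K\<close>, the endomorphisms killing \<open>K\<close> form an
  ideal \<open>A\<close> (\<open>ideal_End_killing\<close>), and each of them factors through \<open>M/K\<close>. Together they give a
  homomorphism from a direct sum of copies of \<open>M/K\<close>, indexed by \<open>A\<close>, onto the submodule \<open>T\<close>
  generated by the images \<open>f(M)\<close>, \<open>f \<in> A\<close> (\<open>direct_sum_mod_hom\<close>). This \<open>T\<close> is fully invariant
  since \<open>A\<close> is a left ideal. If it were proper, the ideal \<open>B\<close> of endomorphisms killing \<open>T\<close> would
  satisfy \<open>BA = 0\<close>; coretractability makes both \<open>A\<close> and \<open>B\<close> non-zero, which contradicts primeness.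
\<close>

section \<open>Submodules and homomorphisms over an arbitrary ring\<close>

lemma carrier_End_ring: "carrier (End_ring R M) = mod_hom R M M"
  by (simp add: End_ring_def)

lemma zero_End_ring: "\<zero>\<^bsub>End_ring R M\<^esub> = (\<lambda>x\<in>carrier M. \<zero>\<^bsub>M\<^esub>)"
  by (simp add: End_ring_def)

lemma mult_End_ring_apply: "x \<in> carrier M \<Longrightarrow> (f \<otimes>\<^bsub>End_ring R M\<^esub> g) x = f (g x)"
  by (simp add: End_ring_def compose_def)

lemma add_End_ring_apply: "x \<in> carrier M \<Longrightarrow> (f \<oplus>\<^bsub>End_ring R M\<^esub> g) x = f x \<oplus>\<^bsub>M\<^esub> g x"
  by (simp add: End_ring_def)

lemma mod_hom_closed: "f \<in> mod_hom R M N \<Longrightarrow> x \<in> carrier M \<Longrightarrow> f x \<in> carrier N"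
  by (auto simp: mod_hom_def)

lemma mod_hom_add:
  "f \<in> mod_hom R M N \<Longrightarrow> x \<in> carrier M \<Longrightarrow> y \<in> carrier M \<Longrightarrow> f (x \<oplus>\<^bsub>M\<^esub> y) = f x \<oplus>\<^bsub>N\<^esub> f y"
  by (simp add: mod_hom_def)

lemma mod_hom_smult:
  "f \<in> mod_hom R M N \<Longrightarrow> r \<in> carrier R \<Longrightarrow> x \<in> carrier M \<Longrightarrow> f (r \<odot>\<^bsub>M\<^esub> x) = r \<odot>\<^bsub>N\<^esub> f x"
  by (simp add: mod_hom_def)

lemma mod_homI:
  assumes "f \<in> carrier M \<rightarrow>\<^sub>E carrier N"
    and "\<And>x y. x \<in> carrier M \<Longrightarrow> y \<in> carrier M \<Longrightarrow> f (x \<oplus>\<^bsub>M\<^esub> y) = f x \<oplus>\<^bsub>N\<^esub> f y"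
    and "\<And>r x. r \<in> carrier R \<Longrightarrow> x \<in> carrier M \<Longrightarrow> f (r \<odot>\<^bsub>M\<^esub> x) = r \<odot>\<^bsub>N\<^esub> f x"
  shows "f \<in> mod_hom R M N"
  using assms by (simp add: mod_hom_def)

lemma End_eq_zero_iff:
  assumes "f \<in> carrier (End_ring R M)"
  shows "f = \<zero>\<^bsub>End_ring R M\<^esub> \<longleftrightarrow> (\<forall>x\<in>carrier M. f x = \<zero>\<^bsub>M\<^esub>)"
proof
  assume *: "\<forall>x\<in>carrier M. f x = \<zero>\<^bsub>M\<^esub>"
  have "f \<in> extensional (carrier M)"
    using assms by (auto simp: carrier_End_ring mod_hom_def PiE_def)
  then show "f = \<zero>\<^bsub>End_ring R M\<^esub>"
    by (rule extensionalityI) (use * in \<open>auto simp: zero_End_ring\<close>)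
qed (simp add: zero_End_ring)

context left_module
begin

lemma smult_l_null:
  assumes "x \<in> carrier M" shows "\<zero>\<^bsub>R\<^esub> \<odot>\<^bsub>M\<^esub> x = \<zero>\<^bsub>M\<^esub>"
proof -
  have "\<zero>\<^bsub>R\<^esub> \<odot>\<^bsub>M\<^esub> x \<oplus>\<^bsub>M\<^esub> \<zero>\<^bsub>R\<^esub> \<odot>\<^bsub>M\<^esub> x = \<zero>\<^bsub>R\<^esub> \<odot>\<^bsub>M\<^esub> x"
    using smult_l_distr[of "\<zero>\<^bsub>R\<^esub>" "\<zero>\<^bsub>R\<^esub>" x] assms by simp
  then show ?thesis using assms by (simp add: M.add.r_cancel_one)
qed

lemma smult_l_minus:
  assumes a: "a \<in> carrier R" and x: "x \<in> carrier M"
  shows "(\<ominus>\<^bsub>R\<^esub> a) \<odot>\<^bsub>M\<^esub> x = \<ominus>\<^bsub>M\<^esub> (a \<odot>\<^bsub>M\<^esub> x)"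
proof -
  have "(\<ominus>\<^bsub>R\<^esub> a) \<odot>\<^bsub>M\<^esub> x \<oplus>\<^bsub>M\<^esub> a \<odot>\<^bsub>M\<^esub> x = \<zero>\<^bsub>M\<^esub>"
    using smult_l_distr[of "\<ominus>\<^bsub>R\<^esub> a" a x] a x by (simp add: R.l_neg smult_l_null)
  then show ?thesis using a x by (simp add: M.minus_equality)
qed

text \<open>Negation is multiplication by \<open>- 1\<close>, so closure under it is automatic.\<close>

lemma submoduleI:
  assumes sub: "H \<subseteq> carrier M" and zero: "\<zero>\<^bsub>M\<^esub> \<in> H"
    and add: "\<And>x y. x \<in> H \<Longrightarrow> y \<in> H \<Longrightarrow> x \<oplus>\<^bsub>M\<^esub> y \<in> H"
    and smult: "\<And>a x. a \<in> carrier R \<Longrightarrow> x \<in> H \<Longrightarrow> a \<odot>\<^bsub>M\<^esub> x \<in> H"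
  shows "submodule H R M"
proof -
  have "\<ominus>\<^bsub>M\<^esub> x \<in> H" if "x \<in> H" for x
  proof -
    have "(\<ominus>\<^bsub>R\<^esub> \<one>\<^bsub>R\<^esub>) \<odot>\<^bsub>M\<^esub> x \<in> H" using that by (intro smult) auto
    then show ?thesis using that sub by (auto simp: smult_l_minus)
  qed
  then show ?thesis
    using assms
    by (intro submodule.intro subgroup.intro submodule_axioms.intro) (auto simp: a_inv_def)
qed

lemma submoduleD:
  assumes "submodule H R M"
  shows "H \<subseteq> carrier M" "\<zero>\<^bsub>M\<^esub> \<in> H"
    "\<And>x y. x \<in> H \<Longrightarrow> y \<in> H \<Longrightarrow> x \<oplus>\<^bsub>M\<^esub> y \<in> H"
    "\<And>a x. a \<in> carrier R \<Longrightarrow> x \<in> H \<Longrightarrow> a \<odot>\<^bsub>M\<^esub> x \<in> H"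
proof -
  interpret H: submodule H R M by fact
  show "H \<subseteq> carrier M" "\<zero>\<^bsub>M\<^esub> \<in> H"
    "\<And>x y. x \<in> H \<Longrightarrow> y \<in> H \<Longrightarrow> x \<oplus>\<^bsub>M\<^esub> y \<in> H"
    "\<And>a x. a \<in> carrier R \<Longrightarrow> x \<in> H \<Longrightarrow> a \<odot>\<^bsub>M\<^esub> x \<in> H"
    using H.subset H.one_closed H.m_closed by auto
qed

lemma End_zero: "f \<in> carrier (End_ring R M) \<Longrightarrow> f \<zero>\<^bsub>M\<^esub> = \<zero>\<^bsub>M\<^esub>"
  using mod_hom_zero[OF M.abelian_group_axioms M.abelian_group_axioms] carrier_End_ring by metis

section \<open>The submodule generated by a left ideal\<close>

text \<open>
  The next three lemmas present \<open>IM\<close> as inductively generated from \<open>0\<close> by adding one product at a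
  time. Later arguments use this induction and avoid reindexing finite sums.
\<close>

lemma left_ideal_smult_zero: "\<zero>\<^bsub>M\<^esub> \<in> left_ideal_smult I M"
  unfolding left_ideal_smult_def by (rule CollectI, rule exI[of _ 0]) auto

lemma left_ideal_smult_step:
  assumes I: "I \<subseteq> carrier R" and s: "s \<in> left_ideal_smult I M"
    and b: "b \<in> I" and y: "y \<in> carrier M"
  shows "s \<oplus>\<^bsub>M\<^esub> b \<odot>\<^bsub>M\<^esub> y \<in> left_ideal_smult I M"
proof -
  obtain n :: nat and a x where s_eq: "s = (\<Oplus>\<^bsub>M\<^esub> i \<in> {..<n}. a i \<odot>\<^bsub>M\<^esub> x i)"
    and a: "a \<in> {..<n} \<rightarrow> I" and x: "x \<in> {..<n} \<rightarrow> carrier M"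
    using s unfolding left_ideal_smult_def by blast
  let ?a = "a(n := b)" and ?x = "x(n := y)"
  have "(\<Oplus>\<^bsub>M\<^esub> i \<in> {..<n}. ?a i \<odot>\<^bsub>M\<^esub> ?x i) = s"
    unfolding s_eq by (rule M.finsum_cong') (use a x I in auto)
  moreover have "(\<Oplus>\<^bsub>M\<^esub> i \<in> {..<Suc n}. ?a i \<odot>\<^bsub>M\<^esub> ?x i)
      = b \<odot>\<^bsub>M\<^esub> y \<oplus>\<^bsub>M\<^esub> (\<Oplus>\<^bsub>M\<^esub> i \<in> {..<n}. ?a i \<odot>\<^bsub>M\<^esub> ?x i)"
    unfolding lessThan_Suc by (subst M.finsum_insert) (use a x I b y in \<open>auto simp: Pi_def\<close>)
  moreover have "s \<in> carrier M" unfolding s_eq by (rule M.finsum_closed) (use a x I in auto)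
  ultimately have "s \<oplus>\<^bsub>M\<^esub> b \<odot>\<^bsub>M\<^esub> y = (\<Oplus>\<^bsub>M\<^esub> i \<in> {..<Suc n}. ?a i \<odot>\<^bsub>M\<^esub> ?x i)"
    using b y I by (auto simp: M.a_comm)
  moreover have "?a \<in> {..<Suc n} \<rightarrow> I" "?x \<in> {..<Suc n} \<rightarrow> carrier M"
    using a x b y by (auto simp: less_Suc_eq)
  ultimately show ?thesis unfolding left_ideal_smult_def by blast
qed

lemma left_ideal_smult_induct [consumes 2, case_names zero step]:
  assumes I: "I \<subseteq> carrier R" and s: "s \<in> left_ideal_smult I M"
    and zero: "P \<zero>\<^bsub>M\<^esub>"
    and step: "\<And>s b y. s \<in> carrier M \<Longrightarrow> P s \<Longrightarrow> b \<in> I \<Longrightarrow> y \<in> carrier M \<Longrightarrow> P (s \<oplus>\<^bsub>M\<^esub> b \<odot>\<^bsub>M\<^esub> y)"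
  shows "P s"
proof -
  obtain n :: nat and a x where s_eq: "s = (\<Oplus>\<^bsub>M\<^esub> i \<in> {..<n}. a i \<odot>\<^bsub>M\<^esub> x i)"
    and a: "a \<in> {..<n} \<rightarrow> I" and x: "x \<in> {..<n} \<rightarrow> carrier M"
    using s unfolding left_ideal_smult_def by blast
  from a x have "P (\<Oplus>\<^bsub>M\<^esub> i \<in> {..<n}. a i \<odot>\<^bsub>M\<^esub> x i)"
  proof (induction n)
    case 0
    then show ?case by (simp add: zero)
  next
    case (Suc n)
    let ?s = "\<Oplus>\<^bsub>M\<^esub> i \<in> {..<n}. a i \<odot>\<^bsub>M\<^esub> x i"
    have ax: "a i \<odot>\<^bsub>M\<^esub> x i \<in> carrier M" if "i < Suc n" for i
      using Suc.prems I that by (intro smult_closed) auto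
    have s: "?s \<in> carrier M" by (rule M.finsum_closed) (use ax in auto)
    have n: "a n \<in> I" "x n \<in> carrier M" using Suc.prems by auto
    have "(\<Oplus>\<^bsub>M\<^esub> i \<in> {..<Suc n}. a i \<odot>\<^bsub>M\<^esub> x i) = a n \<odot>\<^bsub>M\<^esub> x n \<oplus>\<^bsub>M\<^esub> ?s"
      unfolding lessThan_Suc by (subst M.finsum_insert) (use ax in auto)
    also have "\<dots> = ?s \<oplus>\<^bsub>M\<^esub> a n \<odot>\<^bsub>M\<^esub> x n" using s n I by (auto simp: M.a_comm)
    moreover have "P ?s" using Suc by (intro Suc.IH) auto
    ultimately show ?case using step[OF s _ n] by simp
  qed
  then show ?thesis by (simp add: s_eq)
qed

lemma smult_in_left_ideal_smult:
  assumes "I \<subseteq> carrier R" "b \<in> I" "y \<in> carrier M"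
  shows "b \<odot>\<^bsub>M\<^esub> y \<in> left_ideal_smult I M"
  using left_ideal_smult_step[OF assms(1) left_ideal_smult_zero assms(2,3)] assms by auto

lemma left_ideal_subset: "left_ideal I R \<Longrightarrow> I \<subseteq> carrier R"
  by (simp add: left_ideal_def additive_subgroup.a_subset)

text \<open>
  Scalars map \<open>IM\<close> to itself because \<open>r (b y) = (r b) y\<close> with \<open>r b \<in> I\<close>, endomorphisms because
  \<open>f (b y) = b f(y)\<close>.
\<close>

lemma left_ideal_smult_fully_invariant:
  assumes "left_ideal I R"
  shows "fully_invariant R M (left_ideal_smult I M)"
proof -
  let ?L = "left_ideal_smult I M"
  have I: "I \<subseteq> carrier R" using left_ideal_subset[OF assms] .
  have rI: "r \<otimes>\<^bsub>R\<^esub> b \<in> I" if "r \<in> carrier R" "b \<in> I" for r b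
    using assms that by (simp add: left_ideal_def)
  have L: "s \<in> carrier M" if "s \<in> ?L" for s
    using I that by (induction rule: left_ideal_smult_induct) (use I in auto)
  have add: "t \<oplus>\<^bsub>M\<^esub> s \<in> ?L" if t: "t \<in> ?L" and s: "s \<in> ?L" for s t
    using I s
  proof (induction rule: left_ideal_smult_induct)
    case zero
    then show ?case using t L by simp
  next
    case (step s b y)
    have "t \<oplus>\<^bsub>M\<^esub> (s \<oplus>\<^bsub>M\<^esub> b \<odot>\<^bsub>M\<^esub> y) = (t \<oplus>\<^bsub>M\<^esub> s) \<oplus>\<^bsub>M\<^esub> b \<odot>\<^bsub>M\<^esub> y"
      using step L[OF t] I by (auto simp: M.a_assoc)
    then show ?case using left_ideal_smult_step[OF I] step by simp
  qed
  have smult: "r \<odot>\<^bsub>M\<^esub> s \<in> ?L" if r: "r \<in> carrier R" and s: "s \<in> ?L" for r s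
    using I s
  proof (induction rule: left_ideal_smult_induct)
    case zero
    then show ?case using r by (simp add: smult_r_null left_ideal_smult_zero)
  next
    case (step s b y)
    have "r \<odot>\<^bsub>M\<^esub> (s \<oplus>\<^bsub>M\<^esub> b \<odot>\<^bsub>M\<^esub> y) = r \<odot>\<^bsub>M\<^esub> s \<oplus>\<^bsub>M\<^esub> (r \<otimes>\<^bsub>R\<^esub> b) \<odot>\<^bsub>M\<^esub> y"
      using step r I by (auto simp: smult_r_distr smult_assoc1)
    then show ?case using left_ideal_smult_step[OF I _ rI[OF r step(2)]] step by simp
  qed
  have inv: "f s \<in> ?L" if f: "f \<in> mod_hom R M M" and s: "s \<in> ?L" for f s
    using I s
  proof (induction rule: left_ideal_smult_induct)
    case zero
    then show ?case using f End_zero[of f] by (simp add: carrier_End_ring left_ideal_smult_zero)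
  next
    case (step s b y)
    have "f (s \<oplus>\<^bsub>M\<^esub> b \<odot>\<^bsub>M\<^esub> y) = f s \<oplus>\<^bsub>M\<^esub> b \<odot>\<^bsub>M\<^esub> f y"
      using step I by (auto simp: mod_hom_add[OF f] mod_hom_smult[OF f])
    then show ?case using left_ideal_smult_step[OF I _ step(2)] step f by (simp add: mod_hom_closed)
  qed
  have "submodule ?L R M"
    using L add smult left_ideal_smult_zero by (intro submoduleI) auto
  then show ?thesis using inv by (auto simp: fully_invariant_def carrier_End_ring)
qed

lemma left_ideal_annihilator:
  assumes "X \<subseteq> carrier M"
  shows "left_ideal (annihilator R M X) R"
proof -
  have "additive_subgroup (annihilator R M X) R"
  proof (intro additive_subgroup.intro R.add.subgroupI)
    show "annihilator R M X \<noteq> {}"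
      using assms R.zero_closed by (auto simp: annihilator_def smult_l_null subset_iff)
    show "\<ominus>\<^bsub>R\<^esub> a \<in> annihilator R M X" if "a \<in> annihilator R M X" for a
      using that assms by (auto simp: annihilator_def smult_l_minus subset_iff)
    show "a \<oplus>\<^bsub>R\<^esub> b \<in> annihilator R M X"
      if "a \<in> annihilator R M X" "b \<in> annihilator R M X" for a b
      using that assms by (auto simp: annihilator_def smult_l_distr subset_iff)
  qed (auto simp: annihilator_def)
  moreover have "r \<otimes>\<^bsub>R\<^esub> a \<in> annihilator R M X"
    if "r \<in> carrier R" "a \<in> annihilator R M X" for r a
    using that assms by (auto simp: annihilator_def smult_assoc1 smult_r_null subset_iff)
  ultimately show ?thesis by (simp add: left_ideal_def)
qed

section \<open>Quotient modules\<close>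

context
  fixes K assumes K: "submodule K R M"
begin

lemma abelian_subgroup_submodule: "abelian_subgroup K M"
  using abelian_subgroupI3[OF additive_subgroup.intro[OF submodule.axioms(1)[OF K]]
      M.abelian_group_axioms] .

lemmas coset_add = abelian_subgroup.a_rcos_sum[OF abelian_subgroup_submodule]
  and mem_own_coset = abelian_subgroup.a_rcos_self[OF abelian_subgroup_submodule]
  and coset_eqI = abelian_subgroup.a_repr_independence'[OF abelian_subgroup_submodule]
  and coset_eq_submodule = abelian_subgroup.a_rcos_const[OF abelian_subgroup_submodule]

lemma carrier_quot_module: "carrier (quot_module M K) = (\<lambda>x. K +>\<^bsub>M\<^esub> x) ` carrier M"
  unfolding quot_module_def A_RCOSETS_def' by (simp add: UNION_singleton_eq_range)

lemma coset_in_quot: "x \<in> carrier M \<Longrightarrow> K +>\<^bsub>M\<^esub> x \<in> carrier (quot_module M K)"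
  by (auto simp: carrier_quot_module)

lemma add_quot_module:
  "x \<in> carrier M \<Longrightarrow> y \<in> carrier M \<Longrightarrow>
    (K +>\<^bsub>M\<^esub> x) \<oplus>\<^bsub>quot_module M K\<^esub> (K +>\<^bsub>M\<^esub> y) = K +>\<^bsub>M\<^esub> (x \<oplus>\<^bsub>M\<^esub> y)"
  by (simp add: quot_module_def coset_add)

lemma zero_quot_module: "\<zero>\<^bsub>quot_module M K\<^esub> = K"
  by (simp add: quot_module_def)

lemma mem_coset: "y \<in> K +>\<^bsub>M\<^esub> x \<longleftrightarrow> (\<exists>k\<in>K. y = k \<oplus>\<^bsub>M\<^esub> x)"
  by (auto simp: a_r_coset_def')

lemma smult_quot_module:
  assumes r: "r \<in> carrier R" and x: "x \<in> carrier M"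
  shows "r \<odot>\<^bsub>quot_module M K\<^esub> (K +>\<^bsub>M\<^esub> x) = K +>\<^bsub>M\<^esub> (r \<odot>\<^bsub>M\<^esub> x)"
proof -
  have "K +>\<^bsub>M\<^esub> (r \<odot>\<^bsub>M\<^esub> y) = K +>\<^bsub>M\<^esub> (r \<odot>\<^bsub>M\<^esub> x)" if y: "y \<in> K +>\<^bsub>M\<^esub> x" for y
  proof -
    from y obtain k where k: "k \<in> K" "y = k \<oplus>\<^bsub>M\<^esub> x" unfolding mem_coset by (elim bexE)
    have "k \<in> carrier M" using k(1) submoduleD(1)[OF K] by (rule rev_subsetD)
    then have "r \<odot>\<^bsub>M\<^esub> y = r \<odot>\<^bsub>M\<^esub> k \<oplus>\<^bsub>M\<^esub> r \<odot>\<^bsub>M\<^esub> x"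
      unfolding k(2) using r x by (simp add: smult_r_distr)
    then have "r \<odot>\<^bsub>M\<^esub> y \<in> K +>\<^bsub>M\<^esub> (r \<odot>\<^bsub>M\<^esub> x)"
      unfolding mem_coset using submoduleD(4)[OF K r k(1)] by (rule bexI)
    from coset_eqI[OF this smult_closed[OF r x]] show ?thesis by (rule sym)
  qed
  then have "(\<Union>y\<in>K +>\<^bsub>M\<^esub> x. K +>\<^bsub>M\<^esub> (r \<odot>\<^bsub>M\<^esub> y)) = K +>\<^bsub>M\<^esub> (r \<odot>\<^bsub>M\<^esub> x)"
    using mem_own_coset[OF x] by (intro SUP_eq_const) blast+
  then show ?thesis by (simp add: quot_module_def)
qed

lemma coset_eq_submodule_iff:
  assumes "x \<in> carrier M" shows "K +>\<^bsub>M\<^esub> x = K \<longleftrightarrow> x \<in> K"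
  using assms mem_own_coset[of x] coset_eq_submodule by blast

text \<open>This turns the annihilator of \<open>M/K\<close> into a condition inside \<open>M\<close>, namely \<open>r M \<subseteq> K\<close>.\<close>

lemma annihilator_quot_module:
  "annihilator R (quot_module M K) (carrier (quot_module M K))
     = {r \<in> carrier R. \<forall>x\<in>carrier M. r \<odot>\<^bsub>M\<^esub> x \<in> K}"
  by (simp add: annihilator_def carrier_quot_module zero_quot_module smult_quot_module
      coset_eq_submodule_iff cong: conj_cong ball_cong)

lemma left_module_quot_module: "left_module R (quot_module M K)"
proof -
  let ?Q = "quot_module M K"
  have Z: "\<zero>\<^bsub>?Q\<^esub> = K +>\<^bsub>M\<^esub> \<zero>\<^bsub>M\<^esub>"
    using coset_eq_submodule_iff[of "\<zero>\<^bsub>M\<^esub>"] submoduleD(2)[OF K] by (simp add: zero_quot_module)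
  have "abelian_group ?Q"
  proof (rule abelian_groupI)
    show "\<zero>\<^bsub>?Q\<^esub> \<in> carrier ?Q" unfolding Z by (simp add: coset_in_quot)
    fix X assume "X \<in> carrier ?Q"
    then obtain x where x: "x \<in> carrier M" "X = K +>\<^bsub>M\<^esub> x" by (auto simp: carrier_quot_module)
    show "\<zero>\<^bsub>?Q\<^esub> \<oplus>\<^bsub>?Q\<^esub> X = X" unfolding Z x(2) using x(1) by (simp add: add_quot_module)
    show "\<exists>Y\<in>carrier ?Q. Y \<oplus>\<^bsub>?Q\<^esub> X = \<zero>\<^bsub>?Q\<^esub>"
      unfolding Z x(2) using x(1)
      by (intro bexI[of _ "K +>\<^bsub>M\<^esub> (\<ominus>\<^bsub>M\<^esub> x)"]) (auto simp: add_quot_module M.l_neg coset_in_quot)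
  qed (auto simp: carrier_quot_module add_quot_module M.a_ac)
  then show ?thesis
    by (intro left_module.intro left_module_axioms.intro R.ring_axioms)
      (auto simp: carrier_quot_module add_quot_module smult_quot_module
        smult_l_distr smult_r_distr smult_assoc1)
qed

text \<open>
  The universal property of the quotient: \<open>f\<close> is constant on each coset of \<open>K\<close>, so its value there
  defines the induced map.
\<close>

lemma mod_hom_quot_module:
  assumes f: "f \<in> mod_hom R M M" and fK: "f ` K \<subseteq> {\<zero>\<^bsub>M\<^esub>}"
  shows "\<exists>g \<in> mod_hom R (quot_module M K) M. \<forall>x\<in>carrier M. g (K +>\<^bsub>M\<^esub> x) = f x"
proof -
  define g where "g = (\<lambda>X\<in>carrier (quot_module M K). the_elem (f ` X))"
  have g: "g (K +>\<^bsub>M\<^esub> x) = f x" if x: "x \<in> carrier M" for x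
  proof -
    have "f y = f x" if y: "y \<in> K +>\<^bsub>M\<^esub> x" for y
    proof -
      from y obtain k where k: "k \<in> K" "y = k \<oplus>\<^bsub>M\<^esub> x" unfolding mem_coset by (elim bexE)
      have "f y = f k \<oplus>\<^bsub>M\<^esub> f x" unfolding k(2) using x submoduleD(1)[OF K] k(1) by (intro mod_hom_add[OF f]) auto
      moreover have "f k = \<zero>\<^bsub>M\<^esub>" using fK k(1) by auto
      ultimately show ?thesis using f x by (simp add: mod_hom_closed)
    qed
    then have "f ` (K +>\<^bsub>M\<^esub> x) = {f x}" using mem_own_coset[OF x] by blast
    then show ?thesis using x by (simp add: g_def coset_in_quot)
  qed
  have "g \<in> mod_hom R (quot_module M K) M"
  proof (rule mod_homI)
    show "g \<in> carrier (quot_module M K) \<rightarrow>\<^sub>E carrier M"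
    proof (rule PiE_I)
      fix X assume "X \<in> carrier (quot_module M K)"
      then show "g X \<in> carrier M" using g f by (auto simp: carrier_quot_module mod_hom_closed)
    qed (simp add: g_def)
  qed (auto simp: carrier_quot_module add_quot_module smult_quot_module g
        mod_hom_add[OF f] mod_hom_smult[OF f])
  then show ?thesis using g by (intro bexI[of _ g] ballI)
qed

end

section \<open>Homomorphisms out of a direct sum\<close>

lemma finsum_in_submodule:
  assumes H: "submodule H R M" and u: "u \<in> F \<rightarrow> H"
  shows "(\<Oplus>\<^bsub>M\<^esub>i\<in>F. u i) \<in> H"
proof (cases "finite F")
  case True
  then show ?thesis using u
  proof (induction F)
    case empty
    then show ?case using submoduleD[OF H] by simp
  next
    case (insert i F)
    have "u \<in> F \<rightarrow> carrier M" "u i \<in> carrier M" using insert.prems submoduleD(1)[OF H] by auto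
    then show ?case using insert submoduleD(3)[OF H] by auto
  qed
qed (simp add: submoduleD[OF H] M.add.finprod_infinite)

lemma smult_finsum:
  assumes "r \<in> carrier R" "u \<in> F \<rightarrow> carrier M"
  shows "r \<odot>\<^bsub>M\<^esub> (\<Oplus>\<^bsub>M\<^esub>i\<in>F. u i) = (\<Oplus>\<^bsub>M\<^esub>i\<in>F. r \<odot>\<^bsub>M\<^esub> u i)"
proof (cases "finite F")
  case True
  then show ?thesis using assms(2)
    by (induction F) (auto simp: smult_r_null smult_r_distr Pi_def assms(1))
qed (simp add: assms(1) smult_r_null M.add.finprod_infinite)

text \<open>
  The universal property of the direct sum. The induced map sends \<open>x\<close> to the sum of the \<open>\<phi> i (x i)\<close>,
  and its image is the smallest submodule containing the images of all \<open>\<phi> i\<close>. Knowing the image in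
  this form is what makes it possible to check below that it is fully invariant.
\<close>

lemma direct_sum_mod_hom:
  assumes N: "left_module R N" and \<phi>_Pi: "\<phi> \<in> I \<rightarrow> mod_hom R N M"
  shows "\<exists>h \<in> mod_hom R (direct_sum_copies I N) M.
    submodule (h ` carrier (direct_sum_copies I N)) R M \<and>
    (\<forall>i\<in>I. \<forall>n\<in>carrier N. \<phi> i n \<in> h ` carrier (direct_sum_copies I N)) \<and>
    (\<forall>H. submodule H R M \<longrightarrow> (\<forall>i\<in>I. \<forall>n\<in>carrier N. \<phi> i n \<in> H) \<longrightarrow>
      h ` carrier (direct_sum_copies I N) \<subseteq> H)"
proof -
  interpret N: left_module R N by fact
  let ?D = "direct_sum_copies I N"
  let ?G = "\<lambda>x. gfinprod (add_monoid M) (\<lambda>i. \<phi> i (x i)) I"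
  define h where "h = (\<lambda>x\<in>carrier ?D. ?G x)"
  note \<phi> = funcset_mem[OF \<phi>_Pi]
  have \<phi>0: "\<phi> i \<zero>\<^bsub>N\<^esub> = \<zero>\<^bsub>M\<^esub>" if "i \<in> I" for i
    using mod_hom_zero[OF N.M.abelian_group_axioms M.abelian_group_axioms \<phi>[OF that]] .
  have xc: "x i \<in> carrier N" if "x \<in> carrier ?D" "i \<in> I" for x i
    using that by (auto simp: direct_sum_copies_def)
  have \<phi>c: "\<phi> i n \<in> carrier M" if "i \<in> I" "n \<in> carrier N" for i n
    using mod_hom_closed[OF \<phi>] that by blast
  have fin: "finite {i \<in> I. \<phi> i (x i) \<noteq> \<zero>\<^bsub>M\<^esub>}" if "x \<in> carrier ?D" for x
  proof (rule finite_subset)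
    show "{i \<in> I. \<phi> i (x i) \<noteq> \<zero>\<^bsub>M\<^esub>} \<subseteq> {i \<in> I. x i \<noteq> \<zero>\<^bsub>N\<^esub>}" using \<phi>0 by auto
    show "finite {i \<in> I. x i \<noteq> \<zero>\<^bsub>N\<^esub>}" using that by (simp add: direct_sum_copies_def)
  qed
  \<comment> \<open>On the direct sum, the possibly infinite sum in \<open>?G\<close> is an ordinary one over any finite set
    containing the support.\<close>
  have G: "?G x = (\<Oplus>\<^bsub>M\<^esub>i\<in>F. \<phi> i (x i))"
    if "x \<in> carrier ?D" "finite F" "{i \<in> I. \<phi> i (x i) \<noteq> \<zero>\<^bsub>M\<^esub>} \<subseteq> F" "F \<subseteq> I" for x F
  proof -
    have "(\<Oplus>\<^bsub>M\<^esub>i\<in>{i \<in> I. \<phi> i (x i) \<noteq> \<zero>\<^bsub>M\<^esub>}. \<phi> i (x i)) = (\<Oplus>\<^bsub>M\<^esub>i\<in>F. \<phi> i (x i))"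
      by (rule M.add.finprod_mono_neutral_cong_left) (use that \<phi>c xc in auto)
    then show ?thesis using fin[OF that(1)] by (simp add: gfinprod_def finsum_def)
  qed
  have D0: "(\<lambda>i\<in>I. \<zero>\<^bsub>N\<^esub>) \<in> carrier ?D" by (auto simp: direct_sum_copies_def)
  have Dadd: "x \<oplus>\<^bsub>?D\<^esub> y \<in> carrier ?D" if "x \<in> carrier ?D" "y \<in> carrier ?D" for x y
  proof -
    have "{i \<in> I. x i \<oplus>\<^bsub>N\<^esub> y i \<noteq> \<zero>\<^bsub>N\<^esub>} \<subseteq> {i \<in> I. x i \<noteq> \<zero>\<^bsub>N\<^esub>} \<union> {i \<in> I. y i \<noteq> \<zero>\<^bsub>N\<^esub>}"
      by auto
    then have "finite {i \<in> I. x i \<oplus>\<^bsub>N\<^esub> y i \<noteq> \<zero>\<^bsub>N\<^esub>}"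
      using that by (auto simp: direct_sum_copies_def intro: finite_subset)
    then show ?thesis using that by (auto simp: direct_sum_copies_def cong: conj_cong)
  qed
  have Dsm: "r \<odot>\<^bsub>?D\<^esub> x \<in> carrier ?D" if "r \<in> carrier R" "x \<in> carrier ?D" for r x
  proof -
    have "{i \<in> I. r \<odot>\<^bsub>N\<^esub> x i \<noteq> \<zero>\<^bsub>N\<^esub>} \<subseteq> {i \<in> I. x i \<noteq> \<zero>\<^bsub>N\<^esub>}"
      using that by (auto simp: N.smult_r_null)
    then have "finite {i \<in> I. r \<odot>\<^bsub>N\<^esub> x i \<noteq> \<zero>\<^bsub>N\<^esub>}"
      using that by (auto simp: direct_sum_copies_def intro: finite_subset)
    then show ?thesis using that by (auto simp: direct_sum_copies_def cong: conj_cong)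
  qed
  have hadd: "h (x \<oplus>\<^bsub>?D\<^esub> y) = h x \<oplus>\<^bsub>M\<^esub> h y" if x: "x \<in> carrier ?D" and y: "y \<in> carrier ?D" for x y
  proof -
    have "?G (x \<oplus>\<^bsub>?D\<^esub> y) = gfinprod (add_monoid M) (\<lambda>i. \<phi> i (x i) \<oplus>\<^bsub>M\<^esub> \<phi> i (y i)) I"
      by (rule M.add.gfinprod_cong)
        (use x y \<phi>c xc in \<open>auto simp: direct_sum_copies_def simp_implies_def mod_hom_add[OF \<phi>]\<close>)
    also have "\<dots> = ?G x \<oplus>\<^bsub>M\<^esub> ?G y"
      using M.add.gfinprod_distrib[of I "\<lambda>i. \<phi> i (x i)" "\<lambda>i. \<phi> i (y i)"]
        fin[OF x] fin[OF y] \<phi>c xc x y by (simp add: Pi_def)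
    finally show ?thesis using x y Dadd by (simp add: h_def)
  qed
  have hsm: "h (r \<odot>\<^bsub>?D\<^esub> x) = r \<odot>\<^bsub>M\<^esub> h x" if r: "r \<in> carrier R" and x: "x \<in> carrier ?D" for r x
  proof -
    let ?F = "{i \<in> I. \<phi> i (x i) \<noteq> \<zero>\<^bsub>M\<^esub>}"
    have \<phi>r: "\<phi> i ((r \<odot>\<^bsub>?D\<^esub> x) i) = r \<odot>\<^bsub>M\<^esub> \<phi> i (x i)" if "i \<in> I" for i
      using that r x xc by (simp add: direct_sum_copies_def mod_hom_smult[OF \<phi>])
    have "?G (r \<odot>\<^bsub>?D\<^esub> x) = (\<Oplus>\<^bsub>M\<^esub>i\<in>?F. \<phi> i ((r \<odot>\<^bsub>?D\<^esub> x) i))"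
      by (rule G[OF Dsm[OF r x] fin[OF x]]) (use \<phi>r r in \<open>auto simp: smult_r_null\<close>)
    also have "\<dots> = (\<Oplus>\<^bsub>M\<^esub>i\<in>?F. r \<odot>\<^bsub>M\<^esub> \<phi> i (x i))"
      by (rule M.finsum_cong') (use \<phi>r \<phi>c xc r x in auto)
    also have "\<dots> = r \<odot>\<^bsub>M\<^esub> (\<Oplus>\<^bsub>M\<^esub>i\<in>?F. \<phi> i (x i))"
      by (rule smult_finsum[symmetric]) (use \<phi>c xc r x in auto)
    also have "\<dots> = r \<odot>\<^bsub>M\<^esub> ?G x" by (subst G[OF x fin[OF x]]) auto
    finally show ?thesis using r x Dsm by (simp add: h_def)
  qed
  have hc: "h x \<in> carrier M" if "x \<in> carrier ?D" for x
    using that \<phi>c xc M.add.gfinprod_closed[of "\<lambda>i. \<phi> i (x i)" I] by (simp add: h_def Pi_def)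
  have "h \<in> mod_hom R ?D M"
    by (rule mod_homI) (use hc hadd hsm in \<open>auto simp: h_def\<close>)
  moreover have "submodule (h ` carrier ?D) R M"
  proof (rule submoduleI)
    have "h (\<lambda>i\<in>I. \<zero>\<^bsub>N\<^esub>) = \<zero>\<^bsub>M\<^esub>"
      using G[OF D0, of "{}"] D0 \<phi>0 by (simp add: h_def)
    then show "\<zero>\<^bsub>M\<^esub> \<in> h ` carrier ?D" using D0 by (metis imageI)
    show "u \<oplus>\<^bsub>M\<^esub> v \<in> h ` carrier ?D" if "u \<in> h ` carrier ?D" "v \<in> h ` carrier ?D" for u v
      using that by (elim imageE) (simp add: Dadd flip: hadd)
    show "r \<odot>\<^bsub>M\<^esub> u \<in> h ` carrier ?D" if "r \<in> carrier R" "u \<in> h ` carrier ?D" for r u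
      using that by (elim imageE) (simp add: Dsm flip: hsm)
  qed (use hc in auto)
  moreover have "\<phi> i n \<in> h ` carrier ?D" if i: "i \<in> I" and n: "n \<in> carrier N" for i n
  proof -
    let ?x = "\<lambda>j\<in>I. if j = i then n else \<zero>\<^bsub>N\<^esub>"
    have "{j \<in> I. ?x j \<noteq> \<zero>\<^bsub>N\<^esub>} \<subseteq> {i}" by auto
    then have "finite {j \<in> I. ?x j \<noteq> \<zero>\<^bsub>N\<^esub>}" by (rule finite_subset) simp
    moreover have "?x \<in> I \<rightarrow>\<^sub>E carrier N" using n by auto
    ultimately have x: "?x \<in> carrier ?D" by (simp add: direct_sum_copies_def)
    have "?G ?x = (\<Oplus>\<^bsub>M\<^esub>j\<in>{i}. \<phi> j (?x j))"
      by (rule G[OF x]) (use i \<phi>0 in auto)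
    also have "\<dots> = \<phi> i n" using i n \<phi>c by (simp add: Pi_def)
    finally have "h ?x = \<phi> i n" using x by (simp add: h_def)
    then show ?thesis using x by (metis imageI)
  qed
  moreover have "h ` carrier ?D \<subseteq> H"
    if H: "submodule H R M" and \<phi>H: "\<And>i n. i \<in> I \<Longrightarrow> n \<in> carrier N \<Longrightarrow> \<phi> i n \<in> H" for H
  proof (rule image_subsetI)
    fix x assume x: "x \<in> carrier ?D"
    have "?G x = (\<Oplus>\<^bsub>M\<^esub>i\<in>{i \<in> I. \<phi> i (x i) \<noteq> \<zero>\<^bsub>M\<^esub>}. \<phi> i (x i))"
      by (rule G[OF x fin[OF x]]) auto
    also have "\<dots> \<in> H" by (rule finsum_in_submodule[OF H]) (use \<phi>H xc x in auto)
    finally show "h x \<in> H" using x by (simp add: h_def)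
  qed
  ultimately show ?thesis by (intro bexI[of _ h] conjI allI impI ballI) auto
qed

section \<open>Ideals of the endomorphism ring\<close>

text \<open>
  The annihilator of any subset is a left ideal of the endomorphism ring; full invariance of \<open>K\<close> makes
  it absorb multiplication on the right as well.
\<close>

lemma ideal_End_killing:
  assumes S: "ring (End_ring R M)" and K: "fully_invariant R M K"
  shows "ideal {f \<in> carrier (End_ring R M). f ` K \<subseteq> {\<zero>\<^bsub>M\<^esub>}} (End_ring R M)"
    (is "ideal ?A ?S")
proof -
  interpret S: ring ?S by fact
  have KM: "x \<in> carrier M" if "x \<in> K" for x
    using K that submoduleD(1) by (auto simp: fully_invariant_def)
  show ?thesis
  proof (rule idealI[OF S])
    show "subgroup ?A (add_monoid ?S)"
    proof (rule S.add.subgroupI)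
      have "\<zero>\<^bsub>?S\<^esub> ` K \<subseteq> {\<zero>\<^bsub>M\<^esub>}" using KM by (auto simp: zero_End_ring)
      then have "\<zero>\<^bsub>?S\<^esub> \<in> ?A" using S.zero_closed by simp
      then show "?A \<noteq> {}" by blast
      show "\<ominus>\<^bsub>?S\<^esub> f \<in> ?A" if f: "f \<in> ?A" for f
      proof -
        let ?g = "\<ominus>\<^bsub>?S\<^esub> f"
        have g: "?g \<in> carrier ?S" using f by simp
        \<comment> \<open>The negative is known only as the additive inverse in the ring, so its values are read
          off from \<open>f + ?g = 0\<close>.\<close>
        have "?g x = \<zero>\<^bsub>M\<^esub>" if x: "x \<in> K" for x
        proof -
          have "(f \<oplus>\<^bsub>?S\<^esub> ?g) x = \<zero>\<^bsub>M\<^esub>" using f KM[OF x] by (simp add: S.r_neg zero_End_ring)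
          then have "f x \<oplus>\<^bsub>M\<^esub> ?g x = \<zero>\<^bsub>M\<^esub>" using KM[OF x] by (simp add: add_End_ring_apply)
          moreover have "f x = \<zero>\<^bsub>M\<^esub>" using f x by auto
          moreover have "?g x \<in> carrier M"
            using g KM[OF x] by (simp add: carrier_End_ring mod_hom_closed)
          ultimately show ?thesis by simp
        qed
        then show ?thesis using g by auto
      qed
      show "f \<oplus>\<^bsub>?S\<^esub> g \<in> ?A" if "f \<in> ?A" "g \<in> ?A" for f g
        using that KM by (auto simp: add_End_ring_apply image_subset_iff)
    qed auto
    show "f \<otimes>\<^bsub>?S\<^esub> a \<in> ?A" if "a \<in> ?A" "f \<in> carrier ?S" for a f
      using that KM End_zero by (auto simp: mult_End_ring_apply image_subset_iff)
    show "a \<otimes>\<^bsub>?S\<^esub> f \<in> ?A" if "a \<in> ?A" "f \<in> carrier ?S" for a f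
      using that KM K by (auto simp: mult_End_ring_apply image_subset_iff fully_invariant_def)
  qed
qed

end

lemma prime_ring_mult_zero:
  assumes S: "prime_ring S" and I: "ideal I S" and J: "ideal J S"
    and zero: "\<And>a b. a \<in> I \<Longrightarrow> b \<in> J \<Longrightarrow> a \<otimes>\<^bsub>S\<^esub> b = \<zero>\<^bsub>S\<^esub>"
  shows "I = {\<zero>\<^bsub>S\<^esub>} \<or> J = {\<zero>\<^bsub>S\<^esub>}"
proof -
  interpret S: ring S using S by (simp add: prime_ring_def)
  have "x = \<zero>\<^bsub>S\<^esub>" if "x \<in> ideal_prod S I J" for x
    using that by induction (auto simp: zero)
  moreover have "\<zero>\<^bsub>S\<^esub> \<in> ideal_prod S I J"
  proof -
    have "\<zero>\<^bsub>S\<^esub> \<in> I" "\<zero>\<^bsub>S\<^esub> \<in> J"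
      using I J by (simp_all add: additive_subgroup.zero_closed ideal.axioms(1))
    then show ?thesis using ideal_prod.prod zero by metis
  qed
  ultimately have "ideal_prod S I J = {\<zero>\<^bsub>S\<^esub>}" by blast
  then show ?thesis using S I J by (simp add: prime_ring_def)
qed

section \<open>The four implications\<close>

context left_module
begin

lemma fully_invariantD:
  assumes "fully_invariant R M K"
  shows "submodule K R M" "K \<subseteq> carrier M"
    "\<And>f x. f \<in> carrier (End_ring R M) \<Longrightarrow> x \<in> K \<Longrightarrow> f x \<in> K"
  using assms submoduleD(1)[of K] by (auto simp: fully_invariant_def)

text \<open>
  With \<open>A = Ann(K)\<close>, the hypothesis on annihilators rules out that \<open>AM\<close> is proper, and every
  endomorphism with image in \<open>K\<close> kills \<open>AM\<close>.
\<close>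

lemma coprime_imp_endo_coprime:
  assumes cop: "coprime_module R M"
    and ann: "\<And>K. proper_fully_invariant R M K \<Longrightarrow>
      \<not> annihilator R M K \<subseteq> annihilator R M (carrier M)"
  shows "endo_coprime R M"
  unfolding endo_coprime_def
proof (intro allI impI ballI)
  fix K f
  assume K: "proper_fully_invariant R M K" and f: "f \<in> carrier (End_ring R M)"
    and fK: "f ` carrier M \<subseteq> K"
  let ?A = "annihilator R M K"
  let ?L = "left_ideal_smult ?A M"
  have KM: "K \<subseteq> carrier M" using K fully_invariantD by (simp add: proper_fully_invariant_def)
  have A: "left_ideal ?A R" using left_ideal_annihilator[OF KM] .
  have AR: "?A \<subseteq> carrier R" using left_ideal_subset[OF A] .
  have L: "fully_invariant R M ?L" using left_ideal_smult_fully_invariant[OF A] .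
  have "?L = carrier M"
  proof (rule ccontr)
    assume "?L \<noteq> carrier M"
    then have "proper_fully_invariant R M ?L" using L by (simp add: proper_fully_invariant_def)
    then have "annihilator R (quot_module M ?L) (carrier (quot_module M ?L))
        = annihilator R M (carrier M)"
      using cop by (simp add: coprime_module_def)
    moreover have "?A \<subseteq> annihilator R (quot_module M ?L) (carrier (quot_module M ?L))"
      using smult_in_left_ideal_smult[OF AR] AR
      by (auto simp: annihilator_quot_module[OF fully_invariantD(1)[OF L]])
    ultimately show False using ann[OF K] by simp
  qed
  have "f s = \<zero>\<^bsub>M\<^esub>" if "s \<in> ?L" for s
    using AR that
  proof (induction rule: left_ideal_smult_induct)
    case zero
    then show ?case using End_zero[OF f] .
  next
    case (step s b y)
    have "f y \<in> K" using fK step by auto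
    then have "b \<odot>\<^bsub>M\<^esub> f y = \<zero>\<^bsub>M\<^esub>" using step by (simp add: annihilator_def)
    moreover have "f (s \<oplus>\<^bsub>M\<^esub> b \<odot>\<^bsub>M\<^esub> y) = f s \<oplus>\<^bsub>M\<^esub> b \<odot>\<^bsub>M\<^esub> f y"
      using step f AR by (auto simp: carrier_End_ring mod_hom_add[of f R] mod_hom_smult[of f R])
    ultimately show ?case using step by simp
  qed
  then show "f = \<zero>\<^bsub>End_ring R M\<^esub>"
    using End_eq_zero_iff[OF f] \<open>?L = carrier M\<close> by auto
qed

text \<open>Commutativity enters by making multiplication by a scalar an endomorphism.\<close>

lemma endo_coprime_imp_coprime:
  assumes R: "cring R" and endo: "endo_coprime R M"
  shows "coprime_module R M"
  unfolding coprime_module_def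
proof (intro allI impI)
  fix K assume K: "proper_fully_invariant R M K"
  have Ksub: "submodule K R M" using K fully_invariantD by (simp add: proper_fully_invariant_def)
  have "r \<odot>\<^bsub>M\<^esub> x = \<zero>\<^bsub>M\<^esub>"
    if r: "r \<in> carrier R" and rK: "\<forall>x\<in>carrier M. r \<odot>\<^bsub>M\<^esub> x \<in> K" and x: "x \<in> carrier M" for r x
  proof -
    define f where "f = (\<lambda>x\<in>carrier M. r \<odot>\<^bsub>M\<^esub> x)"
    have "s \<odot>\<^bsub>M\<^esub> (r \<odot>\<^bsub>M\<^esub> y) = r \<odot>\<^bsub>M\<^esub> (s \<odot>\<^bsub>M\<^esub> y)" if "s \<in> carrier R" "y \<in> carrier M" for s y
      using that r smult_assoc1[of s r y] smult_assoc1[of r s y] cring.cring_simprules(14)[OF R]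
      by simp
    then have f: "f \<in> carrier (End_ring R M)"
      unfolding carrier_End_ring using r by (intro mod_homI) (auto simp: f_def smult_r_distr)
    have "f ` carrier M \<subseteq> K" using rK by (auto simp: f_def)
    then have "f = \<zero>\<^bsub>End_ring R M\<^esub>" using endo K f by (simp add: endo_coprime_def)
    then have "f x = \<zero>\<^bsub>M\<^esub>" using x by (simp add: zero_End_ring)
    then show ?thesis using x by (simp add: f_def)
  qed
  then show "annihilator R (quot_module M K) (carrier (quot_module M K))
      = annihilator R M (carrier M)"
    unfolding annihilator_quot_module[OF Ksub]
    using submoduleD(2)[OF Ksub] by (auto simp: annihilator_def)
qed

text \<open>
  An endomorphism \<open>f \<noteq> 0\<close> killing a proper \<open>IM\<close> has its image in the largest submodule \<open>K\<close> with
  \<open>IK = 0\<close>, which is fully invariant; endo-coprimeness then leaves only \<open>K = M\<close>.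
\<close>

lemma endo_coprime_left_ideal_smult:
  assumes endo: "endo_coprime R M" and cor: "fi_coretractable R M" and I: "left_ideal I R"
  shows "left_ideal_smult I M = {\<zero>\<^bsub>M\<^esub>} \<or> left_ideal_smult I M = carrier M"
proof (rule disjCI)
  assume "left_ideal_smult I M \<noteq> carrier M"
  then have "proper_fully_invariant R M (left_ideal_smult I M)"
    using left_ideal_smult_fully_invariant[OF I] by (simp add: proper_fully_invariant_def)
  then obtain f where f: "f \<in> carrier (End_ring R M)" "f \<noteq> \<zero>\<^bsub>End_ring R M\<^esub>"
    and fI: "f ` left_ideal_smult I M = {\<zero>\<^bsub>M\<^esub>}"
    using cor unfolding fi_coretractable_def by blast
  have IR: "I \<subseteq> carrier R" using left_ideal_subset[OF I] .
  have fM: "f x \<in> carrier M" if "x \<in> carrier M" for x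
    using f(1) that by (simp add: carrier_End_ring mod_hom_closed)
  have hom: "g \<in> carrier (End_ring R M) \<Longrightarrow> b \<in> carrier R \<Longrightarrow> r \<in> carrier R \<Longrightarrow> x \<in> carrier M \<Longrightarrow>
      b \<odot>\<^bsub>M\<^esub> (r \<odot>\<^bsub>M\<^esub> g x) = g (b \<odot>\<^bsub>M\<^esub> (r \<odot>\<^bsub>M\<^esub> x))" for g b r x
    by (simp add: carrier_End_ring mod_hom_smult)
  \<comment> \<open>The factor \<open>r\<close> is needed for \<open>K\<close> to be a submodule: \<open>I\<close> is only a left ideal, so \<open>I x = 0\<close>
    does not imply \<open>I (r x) = 0\<close>.\<close>
  define K where "K = {x \<in> carrier M. \<forall>b\<in>I. \<forall>r\<in>carrier R. b \<odot>\<^bsub>M\<^esub> (r \<odot>\<^bsub>M\<^esub> x) = \<zero>\<^bsub>M\<^esub>}"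
  have "submodule K R M"
  proof (rule submoduleI)
    show "a \<odot>\<^bsub>M\<^esub> x \<in> K" if a: "a \<in> carrier R" and x: "x \<in> K" for a x
    proof -
      have "b \<odot>\<^bsub>M\<^esub> (r \<odot>\<^bsub>M\<^esub> (a \<odot>\<^bsub>M\<^esub> x)) = \<zero>\<^bsub>M\<^esub>" if "b \<in> I" "r \<in> carrier R" for b r
        using that a x by (simp add: K_def flip: smult_assoc1[of r a x])
      then show ?thesis using a x by (auto simp: K_def)
    qed
  qed (use IR in \<open>auto simp: K_def smult_r_null smult_r_distr subset_iff\<close>)
  moreover have "g x \<in> K" if g: "g \<in> carrier (End_ring R M)" and x: "x \<in> K" for g x
    using x g IR hom[OF g] End_zero[OF g]
    by (auto simp: K_def subset_iff carrier_End_ring mod_hom_closed)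
  ultimately have inv: "fully_invariant R M K" by (auto simp: fully_invariant_def)
  have "f ` carrier M \<subseteq> K"
  proof (rule image_subsetI)
    fix x assume x: "x \<in> carrier M"
    have "b \<odot>\<^bsub>M\<^esub> (r \<odot>\<^bsub>M\<^esub> f x) = \<zero>\<^bsub>M\<^esub>" if "b \<in> I" "r \<in> carrier R" for b r
    proof -
      have "b \<odot>\<^bsub>M\<^esub> (r \<odot>\<^bsub>M\<^esub> x) \<in> left_ideal_smult I M"
        using that x by (intro smult_in_left_ideal_smult[OF IR]) auto
      then show ?thesis using hom[OF f(1)] that IR x fI by blast
    qed
    then show "f x \<in> K" using fM[OF x] by (simp add: K_def)
  qed
  then have "K = carrier M"
    using endo f inv unfolding endo_coprime_def proper_fully_invariant_def by blast
  then have ann: "b \<odot>\<^bsub>M\<^esub> y = \<zero>\<^bsub>M\<^esub>" if "b \<in> I" "y \<in> carrier M" for b y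
    using that smult_one[of y] by (force simp: K_def)
  have "s = \<zero>\<^bsub>M\<^esub>" if "s \<in> left_ideal_smult I M" for s
    using IR that by (induction rule: left_ideal_smult_induct) (auto simp: ann)
  then show "left_ideal_smult I M = {\<zero>\<^bsub>M\<^esub>}" using left_ideal_smult_zero by blast
qed

text \<open>
  The trace of \<open>M/K\<close> in \<open>M\<close> is fully invariant. If it were proper, the non-zero ideals killing the
  trace and killing \<open>K\<close> would have product zero.
\<close>

lemma prime_End_imp_fully_coprime:
  assumes cor: "fi_coretractable R M" and prime: "prime_ring (End_ring R M)"
  shows "fully_coprime R M"
  unfolding fully_coprime_def
proof (intro allI impI)
  fix K assume K: "proper_fully_invariant R M K"
  then have inv: "fully_invariant R M K" by (simp add: proper_fully_invariant_def)
  have Ksub: "submodule K R M" using fully_invariantD(1)[OF inv] .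
  let ?S = "End_ring R M" and ?Q = "quot_module M K"
  have S: "ring ?S" using prime by (simp add: prime_ring_def)
  define kill where "kill X = {f \<in> carrier ?S. f ` X \<subseteq> {\<zero>\<^bsub>M\<^esub>}}" for X
  have kill: "ideal (kill X) ?S" if "fully_invariant R M X" for X
    using ideal_End_killing[OF S that] by (simp add: kill_def)
  have kill_nonzero: "kill X \<noteq> {\<zero>\<^bsub>?S\<^esub>}" if X: "proper_fully_invariant R M X" for X
  proof -
    obtain f where "f \<in> carrier ?S" "f \<noteq> \<zero>\<^bsub>?S\<^esub>" "f ` X = {\<zero>\<^bsub>M\<^esub>}"
      using cor X unfolding fi_coretractable_def by blast
    then have "f \<in> kill X" "f \<noteq> \<zero>\<^bsub>?S\<^esub>" by (simp_all add: kill_def)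
    then show ?thesis by blast
  qed
  have "\<exists>g. g \<in> mod_hom R ?Q M \<and> (\<forall>x\<in>carrier M. g (K +>\<^bsub>M\<^esub> x) = f x)" if "f \<in> kill K" for f
  proof -
    have f: "f \<in> mod_hom R M M" "f ` K \<subseteq> {\<zero>\<^bsub>M\<^esub>}"
      using that by (simp_all add: kill_def carrier_End_ring)
    show ?thesis using mod_hom_quot_module[OF Ksub f] by (simp add: Bex_def)
  qed
  then obtain \<phi> where \<phi>: "\<phi> f \<in> mod_hom R ?Q M"
    and \<phi>_coset: "x \<in> carrier M \<Longrightarrow> \<phi> f (K +>\<^bsub>M\<^esub> x) = f x" if "f \<in> kill K" for f x
    by metis
  have "\<phi> \<in> kill K \<rightarrow> mod_hom R ?Q M" using \<phi> by (rule Pi_I)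
  note universal = direct_sum_mod_hom[OF left_module_quot_module[OF Ksub] this]
  let ?D = "direct_sum_copies (kill K) ?Q"
  obtain h where h: "h \<in> mod_hom R ?D M" and sub: "submodule (h ` carrier ?D) R M"
    and contains: "\<forall>f\<in>kill K. \<forall>X\<in>carrier ?Q. \<phi> f X \<in> h ` carrier ?D"
    and least: "\<forall>H. submodule H R M \<longrightarrow>
      (\<forall>f\<in>kill K. \<forall>X\<in>carrier ?Q. \<phi> f X \<in> H) \<longrightarrow> h ` carrier ?D \<subseteq> H"
    using universal
    by (elim bexE conjE)
  let ?T = "h ` carrier ?D"
  have fT: "f x \<in> ?T" if "f \<in> kill K" "x \<in> carrier M" for f x
    using bspec[OF bspec[OF contains that(1)] coset_in_quot[OF Ksub that(2)]] \<phi>_coset[OF that]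
    by simp
  \<comment> \<open>The preimage of \<open>?T\<close> under \<open>g\<close> is a submodule containing every \<open>f(M)\<close>, since \<open>g f\<close> again
    kills \<open>K\<close>; minimality of \<open>?T\<close> then gives \<open>g(?T) \<subseteq> ?T\<close>.\<close>
  have "g x \<in> ?T" if g: "g \<in> carrier ?S" and x: "x \<in> ?T" for g x
  proof -
    have gM: "g \<in> mod_hom R M M" using g by (simp add: carrier_End_ring)
    have "?T \<subseteq> {x \<in> carrier M. g x \<in> ?T}"
    proof (rule least[rule_format])
      show "submodule {x \<in> carrier M. g x \<in> ?T} R M"
        using submoduleD[OF sub] End_zero[OF g]
        by (intro submoduleI) (auto simp: mod_hom_add[OF gM] mod_hom_smult[OF gM])
      show "\<phi> f X \<in> {x \<in> carrier M. g x \<in> ?T}" if f: "f \<in> kill K" and X: "X \<in> carrier ?Q" for f X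
      proof -
        obtain x where x: "x \<in> carrier M" "X = K +>\<^bsub>M\<^esub> x"
          using X unfolding carrier_quot_module[OF Ksub] by (elim imageE)
        have "g \<otimes>\<^bsub>?S\<^esub> f \<in> kill K" using ideal.I_l_closed[OF kill[OF inv] f g] .
        from fT[OF this x(1)] have "g (f x) \<in> ?T" unfolding mult_End_ring_apply[OF x(1)] .
        moreover have "f x \<in> carrier M"
          using f x(1) by (auto simp: kill_def carrier_End_ring mod_hom_closed)
        ultimately show ?thesis using \<phi>_coset[OF f x(1)] x(2) by simp
      qed
    qed
    then show ?thesis using x by blast
  qed
  then have Tinv: "fully_invariant R M ?T" using sub by (auto simp: fully_invariant_def)
  have "?T = carrier M"
  proof (rule ccontr)
    assume "?T \<noteq> carrier M"
    then have T: "proper_fully_invariant R M ?T" using Tinv by (simp add: proper_fully_invariant_def)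
    have "g \<otimes>\<^bsub>?S\<^esub> f = \<zero>\<^bsub>?S\<^esub>" if g: "g \<in> kill ?T" and f: "f \<in> kill K" for f g
    proof -
      have "g \<otimes>\<^bsub>?S\<^esub> f \<in> carrier ?S" using f ideal.I_l_closed[OF kill[OF inv] f, of g] g
        by (simp add: kill_def)
      moreover have "(g \<otimes>\<^bsub>?S\<^esub> f) x = \<zero>\<^bsub>M\<^esub>" if "x \<in> carrier M" for x
        using fT[OF f that] g that by (auto simp: mult_End_ring_apply kill_def image_subset_iff)
      ultimately show ?thesis using End_eq_zero_iff by blast
    qed
    then show False
      using prime_ring_mult_zero[OF prime kill[OF Tinv] kill[OF inv]] kill_nonzero[OF T]
        kill_nonzero[OF K] by blast
  qed
  then show "generated_by R ?Q M"
    using generated_byI[OF left_module_quot_module[OF Ksub] left_module_axioms h] by blast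
qed

end

theorem proposition2p5:
  fixes R :: "('a, 'r) ring_scheme" and M :: "('a, 'b, 'm) module_scheme"
  assumes "left_module R M"
    and "\<one>\<^bsub>R\<^esub> \<noteq> \<zero>\<^bsub>R\<^esub>"
    and "carrier M \<noteq> {\<zero>\<^bsub>M\<^esub>}"
  shows "(coprime_module R M \<and>
          (\<forall>K. proper_fully_invariant R M K \<longrightarrow>
             \<not> annihilator R M K \<subseteq> annihilator R M (carrier M))
          \<longrightarrow> endo_coprime R M)
       \<and> (cring R \<and> endo_coprime R M \<longrightarrow> coprime_module R M)
       \<and> (endo_coprime R M \<and> fi_coretractable R M
          \<longrightarrow> (\<forall>I. left_ideal I R \<longrightarrow>
                 left_ideal_smult I M = {\<zero>\<^bsub>M\<^esub>} \<or> left_ideal_smult I M = carrier M))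
       \<and> (fi_coretractable R M \<and> prime_ring (End_ring R M) \<longrightarrow> fully_coprime R M)"
  using left_module.coprime_imp_endo_coprime[OF assms(1)]
    left_module.endo_coprime_imp_coprime[OF assms(1)]
    left_module.endo_coprime_left_ideal_smult[OF assms(1)]
    left_module.prime_End_imp_fully_coprime[OF assms(1)]
  by blast

end
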